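(* Let $(\Omega,\mathcal{F},\mathbb{P})$ be an atomless probability space and let $\mathcal{M}$ be the set of all random variables $\xi\colon\Omega\to\mathbb{R}$, where two random variables are identified if they have the same law, ordered by the usual stochastic order $\preccurlyeq_{\rm st}$. Let $\psi\colon\mathcal{M}\to(-\infty,\infty]$ be a function with the translation property, i.e. $\psi(\xi+c)=\psi(\xi)+c$ for all $\xi\in\mathcal{M}$ and $c\in\mathbb{R}$. Put $A_0:=\{\xi\in\mathcal{M}\colon\psi(\xi)\le 0\}$ and $\alpha_{\min}(0,u):=\sup_{\xi\in A_0}q_\xi(u)$ for $u\in(0,1)$. Then the following conditions are equivalent: (i) $\psi$ is bounded countably maxitive with respect to $\preccurlyeq_{\rm st}$. (ii) There exists a function $\alpha\colon(0,1)\to[-\infty,\infty)$ such that $$\psi(\xi)=\sup_{u\in(0,1)}\{q_\xi(u)-\alpha(u)\}\quad\text{for all }\xi\in\mathcal{M}.$$ (iii) The mapping $u\mapsto\alpha_{\min}(0,u)$ is real-valued if $A_0\neq\emptyset$, and $$\psi(\xi)=\sup_{u\in(0,1)}\{q_\xi(u)-\alpha_{\min}(0,u)\}\quad\text{for all }\xi\in\mathcal{M}.$$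
   Context: A probability space is atomless if for every $A\in\mathcal{F}$ with $\mathbb{P}(A)>0$ there is $B\in\mathcal{F}$ with $B\subset A$ and $0<\mathbb{P}(B)<\mathbb{P}(A)$. For $\xi\in\mathcal{M}$, the quantile function is $q_\xi\colon(0,1)\to\mathbb{R}$, $q_\xi(u):=\inf\{v\in\mathbb{R}\colon u\le\mathbb{P}(\xi\le v)\}$. The usual stochastic order is: $\xi\preccurlyeq_{\rm st}\eta$ if and only if $q_\xi(u)\le q_\eta(u)$ for all $u\in(0,1)$. Every non-empty countable subset of $\mathcal{M}$ that is bounded from above with respect to $\preccurlyeq_{\rm st}$ has a unique supremum $\vee Y$ in $\mathcal{M}$, given by the pointwise supremum of the quantile functions. The function $\psi$ is bounded countably maxitive if for every non-empty countable $Y\subset\mathcal{M}$: $\sup_{y\in Y}\psi(y)=\psi(\vee Y)$ if $Y$ is bounded from above, and $\sup_{y\in Y}\psi(y)=\infty$ otherwise. Conventions: $\sup\emptyset=-\infty$, and $r-(-\infty)=\infty$ for $r\in\mathbb{R}$. *)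

theory Defs
  imports "HOL-Probability.Probability"
begin

definition atomless_prob_space :: "'a measure \<Rightarrow> bool" where
  "atomless_prob_space P \<longleftrightarrow> prob_space P \<and>
     (\<forall>A\<in>sets P. measure P A > 0 \<longrightarrow>
        (\<exists>B\<in>sets P. B \<subseteq> A \<and> 0 < measure P B \<and> measure P B < measure P A))"

definition same_law :: "'a measure \<Rightarrow> (('a \<Rightarrow> real) \<times> ('a \<Rightarrow> real)) set" where
  "same_law P = {(f, g). f \<in> borel_measurable P \<and> g \<in> borel_measurable P \<and>
                         distr P borel f = distr P borel g}"

text \<open>The elements of \<open>\<M>\<close> are equivalence classes of random variables, represented as sets
  of functions. Values outside \<open>space P\<close> do not affect the law, so they do not separate
  classes.\<close>

definition RV :: "'a measure \<Rightarrow> ('a \<Rightarrow> real) set set" where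
  "RV P = borel_measurable P // same_law P"

definition shift :: "real \<Rightarrow> ('a \<Rightarrow> real) set \<Rightarrow> ('a \<Rightarrow> real) set" where
  "shift c X = (\<lambda>f \<omega>. f \<omega> + c) ` X"

text \<open>The real infimum is a genuine one only for \<open>0 < u < 1\<close>; no other arguments are used.\<close>

definition quantile_fun :: "'a measure \<Rightarrow> ('a \<Rightarrow> real) \<Rightarrow> real \<Rightarrow> real" where
  "quantile_fun P f u = Inf {v. u \<le> measure P {\<omega> \<in> space P. f \<omega> \<le> v}}"

text \<open>Independence of the chosen representative is \<open>quantile_eq\<close> below.\<close>

definition quantile :: "'a measure \<Rightarrow> ('a \<Rightarrow> real) set \<Rightarrow> real \<Rightarrow> real" where
  "quantile P X = quantile_fun P (SOME f. f \<in> X)"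

definition st_le :: "'a measure \<Rightarrow> ('a \<Rightarrow> real) set \<Rightarrow> ('a \<Rightarrow> real) set \<Rightarrow> bool" where
  "st_le P X Y \<longleftrightarrow> (\<forall>u\<in>{0<..<1}. quantile P X u \<le> quantile P Y u)"

definition st_upper_bound :: "'a measure \<Rightarrow> ('a \<Rightarrow> real) set set \<Rightarrow> ('a \<Rightarrow> real) set \<Rightarrow> bool" where
  "st_upper_bound P Y Z \<longleftrightarrow> Z \<in> RV P \<and> (\<forall>X\<in>Y. st_le P X Z)"

definition st_bdd_above :: "'a measure \<Rightarrow> ('a \<Rightarrow> real) set set \<Rightarrow> bool" where
  "st_bdd_above P Y \<longleftrightarrow> (\<exists>Z. st_upper_bound P Y Z)"

definition st_Sup :: "'a measure \<Rightarrow> ('a \<Rightarrow> real) set set \<Rightarrow> ('a \<Rightarrow> real) set" where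
  "st_Sup P Y = (THE Z. st_upper_bound P Y Z \<and> (\<forall>W. st_upper_bound P Y W \<longrightarrow> st_le P Z W))"

definition translation_property :: "'a measure \<Rightarrow> (('a \<Rightarrow> real) set \<Rightarrow> ereal) \<Rightarrow> bool" where
  "translation_property P \<psi> \<longleftrightarrow> (\<forall>X\<in>RV P. \<forall>c. \<psi> (shift c X) = \<psi> X + ereal c)"

definition bounded_countably_maxitive :: "'a measure \<Rightarrow> (('a \<Rightarrow> real) set \<Rightarrow> ereal) \<Rightarrow> bool" where
  "bounded_countably_maxitive P \<psi> \<longleftrightarrow>
     (\<forall>Y. Y \<subseteq> RV P \<longrightarrow> countable Y \<longrightarrow> Y \<noteq> {} \<longrightarrow>
        (SUP X\<in>Y. \<psi> X) = (if st_bdd_above P Y then \<psi> (st_Sup P Y) else \<infinity>))"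

definition acceptance_set :: "'a measure \<Rightarrow> (('a \<Rightarrow> real) set \<Rightarrow> ereal) \<Rightarrow> ('a \<Rightarrow> real) set set" where
  "acceptance_set P \<psi> = {X \<in> RV P. \<psi> X \<le> 0}"

text \<open>\<open>alpha_min0 P \<psi> u\<close> is \<open>\<alpha>\<^sub>m\<^sub>i\<^sub>n(0, u)\<close>. In \<open>ereal\<close> the supremum over the empty set is \<open>-\<infinity>\<close> and
  \<open>ereal r - (-\<infinity>) = \<infinity>\<close>, as required.\<close>

definition alpha_min0 :: "'a measure \<Rightarrow> (('a \<Rightarrow> real) set \<Rightarrow> ereal) \<Rightarrow> real \<Rightarrow> ereal" where
  "alpha_min0 P \<psi> u = (SUP X\<in>acceptance_set P \<psi>. ereal (quantile P X u))"

lemma equiv_same_law: "equiv (borel_measurable P) (same_law P)"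
  by (rule equivI) (auto simp: refl_on_def sym_def trans_def same_law_def)

lemma quantile_fun_cong:
  assumes "(f, g) \<in> same_law P"
  shows "quantile_fun P f = quantile_fun P g"
proof -
  have f: "f \<in> borel_measurable P" and g: "g \<in> borel_measurable P"
    and eq: "distr P borel f = distr P borel g"
    using assms by (auto simp: same_law_def)
  have "measure P {\<omega> \<in> space P. h \<omega> \<le> v} = measure (distr P borel h) {..v}"
    if "h \<in> borel_measurable P" for h :: "'a \<Rightarrow> real" and v
    using that by (subst measure_distr) (auto intro!: arg_cong[where f = "measure P"])
  then show ?thesis
    using f g eq by (simp add: quantile_fun_def fun_eq_iff)
qed

lemma quantile_eq:
  assumes "X \<in> RV P" "f \<in> X"
  shows "quantile P X = quantile_fun P f"
proof -
  have "(SOME g. g \<in> X) \<in> X"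
    using assms(2) by (rule someI[where P = "\<lambda>g. g \<in> X"])
  then have "((SOME g. g \<in> X), f) \<in> same_law P"
    using assms quotient_eq_iff[OF equiv_same_law] unfolding RV_def by blast
  then show ?thesis
    unfolding quantile_def by (rule quantile_fun_cong)
qed

lemma shift_in_RV:
  assumes "X \<in> RV P"
  shows "shift c X \<in> RV P"
proof -
  have shift_law: "((\<lambda>\<omega>. f \<omega> + d), (\<lambda>\<omega>. g \<omega> + d)) \<in> same_law P"
    if "(f, g) \<in> same_law P" for f g :: "'a \<Rightarrow> real" and d
  proof -
    have "distr P borel (\<lambda>\<omega>. h \<omega> + d) = distr (distr P borel h) borel (\<lambda>x. x + d)"
      if "h \<in> borel_measurable P" for h :: "'a \<Rightarrow> real"
      using that by (subst distr_distr) (auto simp: comp_def)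
    with that show ?thesis
      by (auto simp: same_law_def)
  qed
  obtain f where f: "f \<in> borel_measurable P" and X: "X = same_law P `` {f}"
    using assms unfolding RV_def by (rule quotientE)
  have "shift c X = same_law P `` {\<lambda>\<omega>. f \<omega> + c}"
  proof (intro set_eqI iffI)
    fix h assume "h \<in> shift c X"
    then show "h \<in> same_law P `` {\<lambda>\<omega>. f \<omega> + c}"
      using shift_law X by (auto simp: shift_def)
  next
    fix h assume "h \<in> same_law P `` {\<lambda>\<omega>. f \<omega> + c}"
    then have "((\<lambda>\<omega>. f \<omega> + c + (- c)), (\<lambda>\<omega>. h \<omega> + (- c))) \<in> same_law P"
      using shift_law by blast
    then have "(\<lambda>\<omega>. h \<omega> + (- c)) \<in> X"
      by (simp add: X)
    then show "h \<in> shift c X"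
      unfolding shift_def by (rule rev_image_eqI) simp
  qed
  moreover have "(\<lambda>\<omega>. f \<omega> + c) \<in> borel_measurable P"
    using f by simp
  ultimately show ?thesis
    unfolding RV_def by (simp add: quotientI)
qed

end

theory Submission
  imports Defs
begin

text \<open>
  On an atomless space the quantile functions of elements of \<open>\<M>\<close> are exactly the nondecreasing
  left-continuous functions on \<open>(0,1)\<close>: a uniform random variable \<open>U\<close> exists and \<open>g \<circ> U\<close> has quantile
  function \<open>g\<close>. Hence suprema in \<open>\<M>\<close> are pointwise suprema of quantile functions, and (ii) implies (i)
  by interchanging suprema. Conversely, a bounded countably maxitive \<open>\<psi>\<close> is monotone, and its
  acceptance set, if nonempty, has a greatest element \<open>Z\<close>, namely the supremum of a suitable countable
  subset. So \<open>\<alpha>\<^sub>m\<^sub>i\<^sub>n(0, \<cdot>)\<close> is the quantile function of \<open>Z\<close>, and \<open>\<psi> \<xi> \<le> c\<close> iff \<open>\<xi> - c\<close> is accepted iff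
  \<open>q\<^sub>\<xi> - c \<le> q\<^sub>Z\<close>, which is (iii).
\<close>

section \<open>Uniform random variables on atomless spaces\<close>

lemma dyadic_between:
  fixes x y :: real
  assumes "0 \<le> x" "x < y"
  shows "\<exists>n k :: nat. x < k / 2 ^ n \<and> k / 2 ^ n < y"
proof -
  obtain n where n: "(1 / 2) ^ n < y - x"
    using real_arch_pow_inv[of "y - x" "1 / 2"] assms by auto
  \<comment> \<open>Adding 1 to the floor makes the lower inequality strict even when
    \<open>x * 2 ^ n\<close> is an integer.\<close>
  define k where "k = nat \<lfloor>x * 2 ^ n\<rfloor> + 1"
  have k: "real k = \<lfloor>x * 2 ^ n\<rfloor> + 1"
    using assms by (simp add: k_def)
  have "x * 2 ^ n < k" "k \<le> x * 2 ^ n + 1"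
    unfolding k by linarith+
  then have "x < k / 2 ^ n" "k / 2 ^ n \<le> x + (1 / 2) ^ n"
    by (simp_all add: field_simps)
  with n have "x < k / 2 ^ n \<and> k / 2 ^ n < y" by auto
  then show ?thesis by blast
qed

context prob_space
begin

text \<open>An event \<open>B\<close> and a part \<open>C\<close> of it leave a piece,
  \<open>C\<close> or \<open>B - C\<close>, with at most half the mass of \<open>B\<close>. Repeated
  halving makes the mass arbitrarily small.\<close>

lemma atomless_small_subset:
  assumes atomless: "atomless_prob_space M" and A: "A \<in> events" "0 < prob A" and e: "0 < e"
  obtains B where "B \<in> events" "B \<subseteq> A" "0 < prob B" "prob B < e"
proof -
  have "\<exists>B\<in>events. B \<subseteq> A \<and> 0 < prob B \<and> prob B \<le> (1 / 2) ^ n" for n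
  proof (induction n)
    case 0
    with A show ?case by auto
  next
    case (Suc n)
    then obtain B where B: "B \<in> events" "B \<subseteq> A" "0 < prob B" "prob B \<le> (1 / 2) ^ n" by blast
    with atomless obtain C where C: "C \<in> events" "C \<subseteq> B" "0 < prob C" "prob C < prob B"
      unfolding atomless_prob_space_def by blast
    have diff: "prob (B - C) = prob B - prob C"
      using B C by (simp add: finite_measure_Diff)
    show ?case
    proof (cases "prob C \<le> prob B / 2")
      case True
      with B C show ?thesis by (intro bexI[of _ C]) auto
    next
      case False
      with B C diff show ?thesis by (intro bexI[of _ "B - C"]) auto
    qed
  qed
  moreover obtain n where "(1 / 2) ^ n < e"
    using real_arch_pow_inv[of e "1 / 2"] e by auto
  ultimately show ?thesis
    using that by (meson le_less_trans)
qed

lemma atomless_intermediate_value: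
  assumes atomless: "atomless_prob_space M" and A: "A \<in> events" and t: "0 \<le> t" "t \<le> prob A"
  obtains B where "B \<in> events" "B \<subseteq> A" "prob B = t"
proof -
  \<comment> \<open>Greedy exhaustion: each step gains at least half of what can still be gained without exceeding
    \<open>t\<close>, so the union of the steps cannot be enlarged any further.\<close>
  define V where "V B \<longleftrightarrow> B \<in> events \<and> B \<subseteq> A \<and> prob B \<le> t" for B
  have step: "\<exists>C. V C \<and> B \<subseteq> C \<and> (\<forall>D. V D \<and> B \<subseteq> D \<longrightarrow> prob D \<le> 2 * prob C - prob B)"
    if B: "V B" for B
  proof -
    define s where "s = (SUP D\<in>{D. V D \<and> B \<subseteq> D}. prob D)"
    have bdd: "bdd_above (prob ` {D. V D \<and> B \<subseteq> D})"
      by (auto intro: bdd_aboveI2[where M = t] simp: V_def)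
    have le_s: "prob D \<le> s" if "V D" "B \<subseteq> D" for D
      unfolding s_def using that bdd by (auto intro: cSUP_upper)
    show ?thesis
    proof (cases "s \<le> prob B")
      case True
      with B le_s show ?thesis by (intro exI[of _ B]) force
    next
      case False
      \<comment> \<open>Some admissible \<open>C\<close> exceeds the midpoint of
        \<open>prob B\<close> and \<open>s\<close>, which rearranges to
        \<open>s < 2 * prob C - prob B\<close>.\<close>
      then have "(s + prob B) / 2 < s" by simp
      then obtain C where C: "V C" "B \<subseteq> C" "(s + prob B) / 2 < prob C"
        unfolding s_def using B bdd by (subst (asm) less_cSUP_iff) auto
      show ?thesis
        using C le_s by (intro exI[of _ C]) force
    qed
  qed
  have "\<exists>f. \<forall>n. V (f n) \<and> f n \<subseteq> f (Suc n) \<and>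
      (\<forall>D. V D \<and> f n \<subseteq> D \<longrightarrow> prob D \<le> 2 * prob (f (Suc n)) - prob (f n))"
  proof (rule dependent_nat_choice)
    show "\<exists>B. V B" using t by (intro exI[of _ "{}"]) (simp add: V_def)
  qed (rule step)
  then obtain f where f: "\<And>n. V (f n)" "\<And>n. f n \<subseteq> f (Suc n)"
      "\<And>n D. V D \<Longrightarrow> f n \<subseteq> D \<Longrightarrow> prob D \<le> 2 * prob (f (Suc n)) - prob (f n)"
    by blast
  define B where "B = (\<Union>n. f n)"
  have B: "B \<in> events" "B \<subseteq> A"
    using f(1) by (auto simp: B_def V_def)
  have lim: "(\<lambda>n. prob (f n)) \<longlonglongrightarrow> prob B"
    unfolding B_def using f(1,2)
    by (intro finite_Lim_measure_incseq) (auto simp: V_def incseq_Suc_iff)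
  have "prob B \<le> t"
    using f(1) by (intro LIMSEQ_le_const2[OF lim]) (auto simp: V_def)
  moreover have "\<not> prob B < t"
  proof
    assume less: "prob B < t"
    then have "0 < prob (A - B)"
      using A B t by (simp add: finite_measure_Diff)
    then obtain E where E: "E \<in> events" "E \<subseteq> A - B" "0 < prob E" "prob E < t - prob B"
      using atomless_small_subset[OF atomless, of "A - B" "t - prob B"] A B less by auto
    have union: "prob (B \<union> E) = prob B + prob E"
      using B E by (intro finite_measure_Union) auto
    have V: "V (B \<union> E)"
      using B E union by (auto simp: V_def)
    \<comment> \<open>\<open>B \<union> E\<close> is an admissible extension of every
      \<open>f n\<close>. In the limit its mass is at most \<open>prob B\<close>, although
      \<open>E\<close> has positive mass.\<close>
    have "prob (B \<union> E) \<le> 2 * prob (f (Suc n)) - prob (f n)" for n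
      using V by (rule f(3)) (auto simp: B_def)
    then have "prob (B \<union> E) \<le> 2 * prob B - prob B"
      by (intro LIMSEQ_le_const[OF tendsto_diff[OF tendsto_mult[OF tendsto_const LIMSEQ_Suc[OF lim]] lim]])
        auto
    with union E show False by simp
  qed
  ultimately show ?thesis
    using that B by force
qed

lemma atomless_between:
  assumes atomless: "atomless_prob_space M" and AB: "A \<in> events" "B \<in> events" "A \<subseteq> B"
    and t: "prob A \<le> t" "t \<le> prob B"
  obtains C where "C \<in> events" "A \<subseteq> C" "C \<subseteq> B" "prob C = t"
proof -
  have "prob (B - A) = prob B - prob A"
    using AB by (simp add: finite_measure_Diff)
  then obtain D where D: "D \<in> events" "D \<subseteq> B - A" "prob D = t - prob A"
    using atomless_intermediate_value[OF atomless, of "B - A" "t - prob A"] AB t by auto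
  then have "prob (A \<union> D) = t"
    using AB by (subst finite_measure_Union) auto
  with D AB that[of "A \<union> D"] show ?thesis by auto
qed

text \<open>\<open>F n k\<close> plays the role of the event \<open>U < k / 2 ^ n\<close> for a uniform random variable \<open>U\<close>.\<close>

lemma atomless_dyadic_chain:
  assumes atomless: "atomless_prob_space M"
  obtains F :: "nat \<Rightarrow> nat \<Rightarrow> 'a set" where
    "F 0 1 = space M" "\<And>n k. F n k \<in> events" "\<And>n k. prob (F n k) = min 1 (k / 2 ^ n)"
    "\<And>n k m l. real k / 2 ^ n \<le> l / 2 ^ m \<Longrightarrow> F n k \<subseteq> F m l"
proof -
  \<comment> \<open>The truncation at 1 lets \<open>k\<close> range over all natural numbers: beyond
    \<open>2 ^ n\<close> the chain stays at \<open>space M\<close>.\<close>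
  define V where "V n f \<longleftrightarrow> f (2 ^ n) = space M \<and>
      (\<forall>k. f k \<in> events \<and> f k \<subseteq> f (Suc k) \<and> prob (f k) = min 1 (k / 2 ^ n))"
    for n and f :: "nat \<Rightarrow> 'a set"
  have base: "V 0 (\<lambda>k. if k = 0 then {} else space M)"
    unfolding V_def by (simp add: prob_space min_def)
  have step: "\<exists>g. V (Suc n) g \<and> (\<forall>k. g (2 * k) = f k)" if f: "V n f" for n f
  proof -
    have "\<exists>C. C \<in> events \<and> f k \<subseteq> C \<and> C \<subseteq> f (Suc k) \<and>
        prob C = min 1 (real (2 * k + 1) / 2 ^ Suc n)" for k
    proof (rule atomless_between[OF atomless])
      have "min 1 (k / 2 ^ n) \<le> min 1 (real (2 * k + 1) / 2 ^ Suc n)"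
        "min 1 (real (2 * k + 1) / 2 ^ Suc n) \<le> min 1 (Suc k / 2 ^ n)"
        by (intro min.mono; simp add: field_simps)+
      then show "prob (f k) \<le> min 1 (real (2 * k + 1) / 2 ^ Suc n)"
        "min 1 (real (2 * k + 1) / 2 ^ Suc n) \<le> prob (f (Suc k))"
        using f by (simp_all add: V_def)
    qed (use f in \<open>simp_all add: V_def, blast\<close>)
    then obtain C where C: "\<And>k. C k \<in> events" "\<And>k. f k \<subseteq> C k" "\<And>k. C k \<subseteq> f (Suc k)"
        "\<And>k. prob (C k) = min 1 (real (2 * k + 1) / 2 ^ Suc n)"
      by metis
    \<comment> \<open>Even indices keep the old events; odd indices receive the interpolated
      ones.\<close>
    have "V (Suc n) (\<lambda>k. if even k then f (k div 2) else C (k div 2))"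
      unfolding V_def
    proof (intro conjI allI)
      fix k
      show "prob (if even k then f (k div 2) else C (k div 2)) = min 1 (k / 2 ^ Suc n)"
        using f C(4)[of "k div 2"] by (cases "even k") (auto simp: V_def elim!: evenE oddE)
    qed (use f C(1-3) in \<open>auto simp: V_def elim!: oddE\<close>)
    then show ?thesis by (intro exI[of _ "\<lambda>k. if even k then f (k div 2) else C (k div 2)"]) auto
  qed
  have "\<exists>F. \<forall>n. V n (F n) \<and> (\<forall>k. F (Suc n) (2 * k) = F n k)"
    by (rule dependent_nat_choice) (use base step in blast)+
  then obtain F where F: "\<And>n. V n (F n)" "\<And>n k. F (Suc n) (2 * k) = F n k"
    by blast
  \<comment> \<open>Level \<open>n + m\<close> provides a common denominator, so inclusions between
    different levels reduce to monotonicity of a single chain.\<close>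
  have refine: "F (n + m) (2 ^ m * k) = F n k" for n m k
    by (induction m arbitrary: k) (simp_all add: F(2) mult.assoc)
  have "F n k \<subseteq> F m l" if "real k / 2 ^ n \<le> l / 2 ^ m" for n k m l
  proof -
    have "real (2 ^ m * k) \<le> real (2 ^ n * l)"
      using that by (simp add: field_simps)
    then have "2 ^ m * k \<le> 2 ^ n * l"
      by (simp only: of_nat_le_iff)
    moreover have "incseq (F (n + m))"
      using F(1) by (intro incseq_SucI) (simp add: V_def)
    ultimately have "F (n + m) (2 ^ m * k) \<subseteq> F (n + m) (2 ^ n * l)"
      by (rule monoD[rotated])
    then show ?thesis
      using refine[of n m k] refine[of m n l] by (simp only: add.commute[of m n])
  qed
  moreover have "F 0 1 = space M"
    using F(1)[of 0] by (simp add: V_def)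
  ultimately show ?thesis
    using that F(1) by (auto simp: V_def)
qed

text \<open>\<open>W \<omega>\<close> is the infimum of the dyadic fractions whose event contains
  \<open>\<omega>\<close>, so \<open>W < t\<close> is a countable union of chain events.
  \<open>U\<close> corrects \<open>W\<close> to have values in the open unit interval, since it will
  be composed with functions controlled only there.\<close>

lemma atomless_uniform:
  assumes "atomless_prob_space M"
  obtains U where "U \<in> borel_measurable M" "range U \<subseteq> {0<..<1}"
    "\<And>t. t \<in> {0..1} \<Longrightarrow> prob {\<omega> \<in> space M. U \<omega> < t} = t"
proof -
  obtain F :: "nat \<Rightarrow> nat \<Rightarrow> 'a set" where top: "F 0 1 = space M"
    and F: "\<And>n k. F n k \<in> events" "\<And>n k. prob (F n k) = min 1 (k / 2 ^ n)"
    and F_mono: "\<And>n k m l. real k / 2 ^ n \<le> l / 2 ^ m \<Longrightarrow> F n k \<subseteq> F m l"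
    using atomless_dyadic_chain[OF assms] by blast
  define S where "S \<omega> = {real k / 2 ^ n | n k. \<omega> \<in> F n k}" for \<omega>
  define W where "W \<omega> = Inf (S \<omega>)" for \<omega>
  have S: "S \<omega> \<noteq> {}" "bdd_below (S \<omega>)" if "\<omega> \<in> space M" for \<omega>
    using that top by (auto simp: S_def intro!: bdd_belowI[where m = 0])
  have W_nonneg: "0 \<le> W \<omega>" if "\<omega> \<in> space M" for \<omega>
    unfolding W_def using S[OF that] by (intro cInf_greatest) (auto simp: S_def)
  have W_less: "{\<omega> \<in> space M. W \<omega> < t} = (\<Union>(n, k)\<in>{(n, k). k / 2 ^ n < t}. F n k)" for t
  proof -
    have "W \<omega> < t \<longleftrightarrow> (\<exists>n k. \<omega> \<in> F n k \<and> k / 2 ^ n < t)" if "\<omega> \<in> space M" for \<omega>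
      unfolding W_def using S[OF that] by (subst cInf_less_iff) (auto simp: S_def)
    moreover have "\<omega> \<in> space M" if "\<omega> \<in> F n k" for \<omega> n k
      using sets.sets_into_space[OF F(1)] that by blast
    ultimately show ?thesis by (intro set_eqI) (auto; blast)
  qed
  have W_events: "{\<omega> \<in> space M. W \<omega> < t} \<in> events" for t
    unfolding W_less using F(1) by (intro sets.countable_UN') auto
  then have [measurable]: "W \<in> borel_measurable M"
    by (simp add: borel_measurable_iff_less)
  have prob_W: "prob {\<omega> \<in> space M. W \<omega> < t} = t" if t: "t \<in> {0..1}" for t
  proof (rule antisym; rule ccontr)
    assume "\<not> prob {\<omega> \<in> space M. W \<omega> < t} \<le> t"
    then obtain n k :: nat where nk: "t < k / 2 ^ n" "k / 2 ^ n < prob {\<omega> \<in> space M. W \<omega> < t}"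
      using t dyadic_between[of t "prob {\<omega> \<in> space M. W \<omega> < t}"] by auto
    \<comment> \<open>Every event of the union belongs to a fraction below \<open>t\<close>, hence
      lies in \<open>F n k\<close>, whose mass is at most \<open>k / 2 ^ n\<close>.\<close>
    have "{\<omega> \<in> space M. W \<omega> < t} \<subseteq> F n k"
    proof -
      have "F m l \<subseteq> F n k" if "l / 2 ^ m < t" for m l
        using nk that by (intro F_mono) simp
      then show ?thesis unfolding W_less by auto
    qed
    then have "prob {\<omega> \<in> space M. W \<omega> < t} \<le> prob (F n k)"
      using F(1) by (rule finite_measure_mono)
    with nk F(2) show False by simp
  next
    assume "\<not> t \<le> prob {\<omega> \<in> space M. W \<omega> < t}"
    then obtain n k :: nat where nk: "prob {\<omega> \<in> space M. W \<omega> < t} < k / 2 ^ n" "k / 2 ^ n < t"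
      using dyadic_between[of "prob {\<omega> \<in> space M. W \<omega> < t}" t] by auto
    have "prob (F n k) \<le> prob {\<omega> \<in> space M. W \<omega> < t}"
      using nk W_events by (intro finite_measure_mono) (auto simp: W_less)
    with nk t F(2) show False by (simp add: min_def split: if_splits)
  qed
  have "prob {\<omega> \<in> space M. W \<omega> \<le> 0} \<le> e" if "0 < e" for e
  proof (cases "e \<le> 1")
    case True
    have "prob {\<omega> \<in> space M. W \<omega> \<le> 0} \<le> prob {\<omega> \<in> space M. W \<omega> < e}"
      using that by (intro finite_measure_mono) auto
    with True that prob_W show ?thesis by simp
  qed (use prob_le_1 in \<open>auto intro: order_trans\<close>)
  then have "prob {\<omega> \<in> space M. W \<omega> \<le> 0} \<le> 0"
    by (intro field_le_epsilon[of _ 0]) simp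
  then have "prob {\<omega> \<in> space M. W \<omega> \<le> 0} = 0"
    by (simp add: measure_le_0_iff)
  then have "AE \<omega> in M. \<not> W \<omega> \<le> 0"
    using prob_Collect_eq_0[of "\<lambda>\<omega>. W \<omega> \<le> 0"] by simp
  moreover have "AE \<omega> in M. W \<omega> < 1"
    using prob_W[of 1] prob_Collect_eq_1[of "\<lambda>\<omega>. W \<omega> < 1"] by simp
  ultimately have AE_W: "AE \<omega> in M. 0 < W \<omega> \<and> W \<omega> < 1"
    by eventually_elim simp
  \<comment> \<open>The value \<open>1 / 2\<close> is an arbitrary interior point; within
    \<open>space M\<close> it replaces \<open>W\<close> only on a null set.\<close>
  define U where "U \<omega> = (if 0 < W \<omega> \<and> W \<omega> < 1 then W \<omega> else 1 / 2)" for \<omega>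
  have [measurable]: "U \<in> borel_measurable M"
    unfolding U_def by measurable
  have "prob {\<omega> \<in> space M. U \<omega> < t} = prob {\<omega> \<in> space M. W \<omega> < t}" for t
    using AE_W by (intro finite_measure_eq_AE) (auto simp: U_def)
  moreover have "range U \<subseteq> {0<..<1}"
    by (auto simp: U_def)
  ultimately show ?thesis
    using that[of U] prob_W by simp
qed

end

section \<open>Quantile functions and suprema in the stochastic order\<close>

text \<open>Left continuity and monotonicity in a single clause (\<open>v = g u\<close> gives the latter), stated by
  upper bounds so that it visibly passes to pointwise suprema.\<close>

definition left_continuous_mono :: "(real \<Rightarrow> real) \<Rightarrow> bool" where
  "left_continuous_mono g \<longleftrightarrow>
     (\<forall>u\<in>{0<..<1}. \<forall>v. g u \<le> v \<longleftrightarrow> (\<forall>w\<in>{0<..<u}. g w \<le> v))"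

lemma left_continuous_mono_le_iff:
  "left_continuous_mono g \<Longrightarrow> u \<in> {0<..<1} \<Longrightarrow> g u \<le> v \<longleftrightarrow> (\<forall>w\<in>{0<..<u}. g w \<le> v)"
  by (simp add: left_continuous_mono_def)

lemma left_continuous_monoD:
  "left_continuous_mono g \<Longrightarrow> 0 < w \<Longrightarrow> w \<le> u \<Longrightarrow> u < 1 \<Longrightarrow> g w \<le> g u"
  using left_continuous_mono_le_iff[of g u "g u"] by (cases "w = u") auto

text \<open>Both sides of the defining equivalence unfold to bounds for all \<open>i\<close>, and
  universal quantifiers commute. Boundedness keeps the real suprema genuine.\<close>

lemma left_continuous_mono_SUP:
  assumes "I \<noteq> {}" and g: "\<And>i. i \<in> I \<Longrightarrow> left_continuous_mono (g i)"
    and bdd: "\<And>u. u \<in> {0<..<1} \<Longrightarrow> bdd_above ((\<lambda>i. g i u) ` I)"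
  shows "left_continuous_mono (\<lambda>u. SUP i\<in>I. g i u)"
  unfolding left_continuous_mono_def
proof (intro ballI allI)
  fix u v :: real
  assume u: "u \<in> {0<..<1}"
  have SUP_le: "(SUP i\<in>I. g i w) \<le> v \<longleftrightarrow> (\<forall>i\<in>I. g i w \<le> v)" if "w \<in> {0<..<1}" for w
    using \<open>I \<noteq> {}\<close> bdd[OF that] by (rule cSUP_le_iff)
  have "(SUP i\<in>I. g i u) \<le> v \<longleftrightarrow> (\<forall>i\<in>I. \<forall>w\<in>{0<..<u}. g i w \<le> v)"
    using u left_continuous_mono_le_iff[OF g u] by (simp add: SUP_le)
  also have "\<dots> \<longleftrightarrow> (\<forall>w\<in>{0<..<u}. (SUP i\<in>I. g i w) \<le> v)"
    using u by (auto simp: SUP_le)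
  finally show "(SUP i\<in>I. g i u) \<le> v \<longleftrightarrow> (\<forall>w\<in>{0<..<u}. (SUP i\<in>I. g i w) \<le> v)" .
qed

text \<open>For \<open>w < u\<close> a rational \<open>r\<close> fits in between, so
  \<open>g w \<le> g r \<le> h r \<le> h u\<close>, and left continuity of \<open>g\<close> passes
  to \<open>u\<close>. Domination thus has to be checked at countably many levels only.\<close>

lemma left_continuous_mono_le_rat:
  assumes g: "left_continuous_mono g" and h: "left_continuous_mono h"
    and rat: "\<And>r. r \<in> \<rat> \<Longrightarrow> r \<in> {0<..<1} \<Longrightarrow> g r \<le> h r" and u: "u \<in> {0<..<1}"
  shows "g u \<le> h u"
proof (subst left_continuous_mono_le_iff[OF g u], intro ballI)
  fix w assume w: "w \<in> {0<..<u}"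
  then obtain r where r: "r \<in> \<rat>" "w < r" "r < u"
    using Rats_dense_in_real[of w u] by auto
  have "g w \<le> g r" using w r u by (intro left_continuous_monoD[OF g]) auto
  also have "\<dots> \<le> h r" using w r u by (intro rat) auto
  also have "\<dots> \<le> h u" using w r u by (intro left_continuous_monoD[OF h]) auto
  finally show "g w \<le> h u" .
qed

section \<open>Quantile functions as generalized inverses, and their realization\<close>

context prob_space
begin

lemma cdf_distr:
  "f \<in> borel_measurable M \<Longrightarrow> cdf (distr M borel f) v = prob {\<omega> \<in> space M. f \<omega> \<le> v}"
  unfolding cdf_def2 by (subst measure_distr) (auto intro!: arg_cong[where f = prob])

text \<open>This is the Galois connection between quantile function and distribution function; it
  turns questions about quantiles into inequalities between probabilities.\<close>

lemma quantile_fun_le_iff: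
  assumes f: "f \<in> borel_measurable M" and u: "u \<in> {0<..<1}"
  shows "quantile_fun M f u \<le> v \<longleftrightarrow> u \<le> prob {\<omega> \<in> space M. f \<omega> \<le> v}"
proof -
  interpret D: cdf_distribution "distr M borel f"
    unfolding cdf_distribution_def using f by (rule real_distribution_distr)
  show ?thesis
    using D.pseudoinverse[of u v] u by (simp add: quantile_fun_def cdf_distr[OF f])
qed

lemma left_continuous_mono_quantile_fun:
  assumes f: "f \<in> borel_measurable M"
  shows "left_continuous_mono (quantile_fun M f)"
proof -
  have le_iff: "u \<le> p \<longleftrightarrow> (\<forall>w\<in>{0<..<u}. w \<le> p)" if "0 < u" for u p :: real
    using that by (auto intro: dense_le_bounded)
  show ?thesis
    unfolding left_continuous_mono_def
  proof (intro ballI allI)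
    fix u v :: real
    assume "u \<in> {0<..<1}"
    then show "quantile_fun M f u \<le> v \<longleftrightarrow> (\<forall>w\<in>{0<..<u}. quantile_fun M f w \<le> v)"
      using le_iff[of u "prob {\<omega> \<in> space M. f \<omega> \<le> v}"] by (simp add: quantile_fun_le_iff[OF f])
  qed
qed

text \<open>By the Galois connection, quantiles decide which levels \<open>u\<close> in the open
  unit interval lie below a value of the distribution function. Nonpositive levels lie below every
  probability, and a level strictly below a probability is less than 1.\<close>

lemma same_law_if_quantile_fun_eq:
  assumes f: "f \<in> borel_measurable M" and g: "g \<in> borel_measurable M"
    and eq: "\<And>u. u \<in> {0<..<1} \<Longrightarrow> quantile_fun M f u = quantile_fun M g u"
  shows "(f, g) \<in> same_law M"
proof -
  have le: "prob {\<omega> \<in> space M. f \<omega> \<le> v} \<le> prob {\<omega> \<in> space M. g \<omega> \<le> v}"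
    if f: "f \<in> borel_measurable M" and g: "g \<in> borel_measurable M"
      and eq: "\<And>u. u \<in> {0<..<1} \<Longrightarrow> quantile_fun M f u = quantile_fun M g u" for f g v
  proof (rule dense_le)
    fix u assume "u < prob {\<omega> \<in> space M. f \<omega> \<le> v}"
    then show "u \<le> prob {\<omega> \<in> space M. g \<omega> \<le> v}"
      using quantile_fun_le_iff[OF f, of u v] quantile_fun_le_iff[OF g, of u v] eq[of u]
        prob_le_1[of "{\<omega> \<in> space M. f \<omega> \<le> v}"]
        order_trans[OF _ measure_nonneg[of M "{\<omega> \<in> space M. g \<omega> \<le> v}"], of u]
      by (cases "0 < u") auto
  qed
  have "prob {\<omega> \<in> space M. f \<omega> \<le> v} = prob {\<omega> \<in> space M. g \<omega> \<le> v}" for v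
    using assms by (intro antisym le) auto
  then have "cdf (distr M borel f) = cdf (distr M borel g)"
    using f g by (simp add: fun_eq_iff cdf_distr)
  then have "distr M borel f = distr M borel g"
    using f g by (intro cdf_unique real_distribution_distr)
  then show ?thesis
    using f g by (simp add: same_law_def)
qed

lemma RV_representative:
  assumes "X \<in> RV M"
  obtains f where "f \<in> borel_measurable M" "f \<in> X" "X = same_law M `` {f}"
    "quantile M X = quantile_fun M f"
proof -
  obtain f where f: "f \<in> borel_measurable M" "X = same_law M `` {f}"
    using assms unfolding RV_def by (rule quotientE)
  then have "f \<in> X" by (simp add: same_law_def)
  with f that quantile_eq[OF assms] show ?thesis by blast
qed

lemma left_continuous_mono_quantile: "X \<in> RV M \<Longrightarrow> left_continuous_mono (quantile M X)"
  by (metis RV_representative left_continuous_mono_quantile_fun)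

lemma RV_eqI:
  assumes "X \<in> RV M" "Y \<in> RV M" "\<And>u. u \<in> {0<..<1} \<Longrightarrow> quantile M X u = quantile M Y u"
  shows "X = Y"
proof -
  obtain f where f: "f \<in> borel_measurable M" "X = same_law M `` {f}" "quantile M X = quantile_fun M f"
    using assms(1) by (rule RV_representative)
  obtain g where g: "g \<in> borel_measurable M" "Y = same_law M `` {g}" "quantile M Y = quantile_fun M g"
    using assms(2) by (rule RV_representative)
  have "(f, g) \<in> same_law M"
    using f g assms(3) by (intro same_law_if_quantile_fun_eq) auto
  then show ?thesis
    using f(2) g(2) equiv_class_eq[OF equiv_same_law] by blast
qed

lemma quantile_shift:
  assumes X: "X \<in> RV M" and u: "u \<in> {0<..<1}"
  shows "quantile M (shift c X) u = quantile M X u + c"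
proof -
  obtain f where f: "f \<in> borel_measurable M" "f \<in> X" "quantile M X = quantile_fun M f"
    using X by (rule RV_representative)
  have "quantile M (shift c X) = quantile_fun M (\<lambda>\<omega>. f \<omega> + c)"
    using f(2) by (intro quantile_eq shift_in_RV X) (auto simp: shift_def)
  moreover have "quantile_fun M (\<lambda>\<omega>. f \<omega> + c) u \<le> v \<longleftrightarrow> quantile_fun M f u + c \<le> v" for v
    using quantile_fun_le_iff[of "\<lambda>\<omega>. f \<omega> + c" u v] quantile_fun_le_iff[of f u "v - c"] f(1) u
    by (simp add: le_diff_eq)
  ultimately show ?thesis
    unfolding f(3) by (metis order_antisym order_refl)
qed

text \<open>Take \<open>f\<close> as \<open>g\<close> composed with a uniform \<open>U\<close>. If
  \<open>g u \<le> v\<close>, then \<open>U < u\<close> forces \<open>f \<le> v\<close>. If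
  \<open>v < g u\<close>, left continuity gives \<open>w < u\<close> with \<open>v < g w\<close>, so
  \<open>f \<le> v\<close> forces \<open>U < w\<close>, an event of mass below
  \<open>u\<close>.\<close>

lemma atomless_quantile_surj:
  assumes atomless: "atomless_prob_space M" and g: "left_continuous_mono g"
  obtains X where "X \<in> RV M" "\<And>u. u \<in> {0<..<1} \<Longrightarrow> quantile M X u = g u"
proof -
  obtain U where U: "U \<in> borel_measurable M" "range U \<subseteq> {0<..<1}"
    and prob_U: "\<And>t. t \<in> {0..1} \<Longrightarrow> prob {\<omega> \<in> space M. U \<omega> < t} = t"
    using atomless_uniform[OF atomless] by blast
  have U_bounds: "0 < U \<omega>" "U \<omega> < 1" for \<omega>
    using subsetD[OF U(2) rangeI[of U \<omega>]] by auto
  define f where "f \<omega> = g (U \<omega>)" for \<omega>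
  \<comment> \<open>Monotonicity of \<open>g\<close> is available only on the open unit interval, so
    measurability is shown on the restricted space, into which \<open>U\<close> maps.\<close>
  have "g \<in> borel_measurable (restrict_space borel {0<..<1})"
    using left_continuous_monoD[OF g] by (intro borel_measurable_mono_on_fnc mono_onI) auto
  moreover have "U \<in> measurable M (restrict_space borel {0<..<1})"
    using U by (intro measurable_restrict_space2) auto
  ultimately have f: "f \<in> borel_measurable M"
    unfolding f_def by (rule measurable_compose[rotated])
  have le_iff: "u \<le> prob {\<omega> \<in> space M. f \<omega> \<le> v} \<longleftrightarrow> g u \<le> v" if u: "u \<in> {0<..<1}" for u v
  proof
    assume "g u \<le> v"
    moreover have "f \<omega> \<le> g u" if "U \<omega> < u" for \<omega>
      using left_continuous_monoD[OF g, of "U \<omega>" u] U_bounds that u by (simp add: f_def)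
    ultimately have "prob {\<omega> \<in> space M. U \<omega> < u} \<le> prob {\<omega> \<in> space M. f \<omega> \<le> v}"
      using f by (intro finite_measure_mono) (auto intro: order_trans)
    with prob_U[of u] u show "u \<le> prob {\<omega> \<in> space M. f \<omega> \<le> v}" by simp
  next
    assume le: "u \<le> prob {\<omega> \<in> space M. f \<omega> \<le> v}"
    show "g u \<le> v"
    proof (rule ccontr)
      assume "\<not> g u \<le> v"
      then have "\<exists>w\<in>{0<..<u}. v < g w"
        using left_continuous_mono_le_iff[OF g u, of v] by (simp add: not_le)
      then obtain w where w: "w \<in> {0<..<u}" "v < g w" by blast
      have "U \<omega> < w" if "f \<omega> \<le> v" for \<omega>
        using left_continuous_monoD[OF g, of w "U \<omega>"] U_bounds[of \<omega>] that w
        by (intro not_le_imp_less notI) (auto simp: f_def)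
      then have "prob {\<omega> \<in> space M. f \<omega> \<le> v} \<le> prob {\<omega> \<in> space M. U \<omega> < w}"
        using U(1) by (intro finite_measure_mono) auto
      with prob_U[of w] w le u show False by simp
    qed
  qed
  define X where "X = same_law M `` {f}"
  have X: "X \<in> RV M" "f \<in> X"
    unfolding X_def RV_def by (intro quotientI f) (use f in \<open>simp add: same_law_def\<close>)
  have "quantile M X u = g u" if "u \<in> {0<..<1}" for u
    using quantile_fun_le_iff[OF f that] le_iff[OF that] quantile_eq[OF X] by (metis order_antisym order_refl)
  with X(1) that show ?thesis by blast
qed

text \<open>The pointwise supremum is again \<open>left_continuous_mono\<close>, hence the quantile
  function of some \<open>Z\<close>. This \<open>Z\<close> is a least upper bound, and
  \<open>RV_eqI\<close> supplies the uniqueness that the description operator in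
  \<open>st_Sup\<close> requires.\<close>

lemma
  assumes atomless: "atomless_prob_space M" and Y: "Y \<subseteq> RV M" "Y \<noteq> {}"
  shows st_bdd_above_iff:
      "st_bdd_above M Y \<longleftrightarrow> (\<forall>u\<in>{0<..<1}. bdd_above ((\<lambda>X. quantile M X u) ` Y))"
    and st_Sup_in_RV: "st_bdd_above M Y \<Longrightarrow> st_Sup M Y \<in> RV M"
    and quantile_st_Sup: "st_bdd_above M Y \<Longrightarrow> u \<in> {0<..<1} \<Longrightarrow>
      quantile M (st_Sup M Y) u = (SUP X\<in>Y. quantile M X u)"
proof -
  let ?bdd = "\<forall>u\<in>{0<..<1}. bdd_above ((\<lambda>X. quantile M X u) ` Y)"
  have bdd: ?bdd if "st_bdd_above M Y"
    using that unfolding st_bdd_above_def st_upper_bound_def st_le_def bdd_above_def by fast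
  have *: "st_bdd_above M Y \<and> st_Sup M Y \<in> RV M \<and>
      (\<forall>u\<in>{0<..<1}. quantile M (st_Sup M Y) u = (SUP X\<in>Y. quantile M X u))" if ?bdd
  proof -
    have "left_continuous_mono (\<lambda>u. SUP X\<in>Y. quantile M X u)"
      using Y \<open>?bdd\<close> by (intro left_continuous_mono_SUP left_continuous_mono_quantile) auto
    then obtain Z where Z: "Z \<in> RV M"
        "\<And>u. u \<in> {0<..<1} \<Longrightarrow> quantile M Z u = (SUP X\<in>Y. quantile M X u)"
      using atomless_quantile_surj[OF atomless] by blast
    have ub: "st_upper_bound M Y Z"
      using Z \<open>?bdd\<close> by (auto simp: st_upper_bound_def st_le_def intro!: cSUP_upper)
    have least: "st_le M Z W" if "st_upper_bound M Y W" for W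
      using Z(2) that Y by (auto simp: st_upper_bound_def st_le_def intro!: cSUP_least)
    have "st_Sup M Y = Z"
      unfolding st_Sup_def
    proof (rule the_equality)
      fix W assume W: "st_upper_bound M Y W \<and> (\<forall>V. st_upper_bound M Y V \<longrightarrow> st_le M W V)"
      show "W = Z"
      proof (rule RV_eqI)
        show "W \<in> RV M" using W by (simp add: st_upper_bound_def)
        show "quantile M W u = quantile M Z u" if "u \<in> {0<..<1}" for u
          using W ub least that by (intro antisym) (auto simp: st_le_def)
      qed (rule Z(1))
    qed (use ub least in blast)
    with Z ub show ?thesis by (auto simp: st_bdd_above_def)
  qed
  show "st_bdd_above M Y \<longleftrightarrow> ?bdd"
    using bdd conjunct1[OF *] by (rule iffI)
  show "st_Sup M Y \<in> RV M" if "st_bdd_above M Y"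
    using * bdd[OF that] by blast
  show "quantile M (st_Sup M Y) u = (SUP X\<in>Y. quantile M X u)"
    if "st_bdd_above M Y" "u \<in> {0<..<1}"
    using * bdd[OF that(1)] that(2) by blast
qed

end

section \<open>Bounded countably maxitive functions\<close>

text \<open>Links the real suprema of quantiles to the extended real ones in the representation of
  \<psi>; on unbounded families the real supremum carries no information.\<close>

lemma SUP_ereal_eq_if_bdd_above:
  fixes f :: "'i \<Rightarrow> real"
  assumes "I \<noteq> {}"
  shows "(SUP i\<in>I. ereal (f i)) = (if bdd_above (f ` I) then ereal (SUP i\<in>I. f i) else \<infinity>)"
proof (cases "bdd_above (f ` I)")
  case True
  then obtain b where b: "\<And>i. i \<in> I \<Longrightarrow> f i \<le> b"
    by (auto simp: bdd_above_def)
  obtain i where "i \<in> I" using assms by blast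
  then have "ereal (f i) \<le> (SUP i\<in>I. ereal (f i))"
    by (intro SUP_upper)
  moreover have "(SUP i\<in>I. ereal (f i)) \<le> ereal b"
    using b by (intro SUP_least) simp
  ultimately have "\<bar>SUP i\<in>I. ereal (f i)\<bar> \<noteq> \<infinity>"
    by auto
  with True show ?thesis by (simp add: ereal_SUP)
next
  case False
  have "(SUP i\<in>I. ereal (f i)) = \<infinity>"
  proof (rule ereal_top)
    fix b
    obtain i where "i \<in> I" "b < f i"
      using False unfolding bdd_above_def by (auto simp: not_le)
    then show "ereal b \<le> (SUP i\<in>I. ereal (f i))"
      by (intro SUP_upper2[of i]) auto
  qed
  with False show ?thesis by simp
qed

text \<open>Maxitivity speaks only about countable families; this extracts one that keeps the
  supremum at a given level.\<close>

lemma countable_subset_SUP_eq: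
  fixes f :: "'i \<Rightarrow> ereal"
  assumes "A \<noteq> {}"
  obtains C where "C \<subseteq> A" "C \<noteq> {}" "countable C" "(SUP i\<in>C. f i) = (SUP i\<in>A. f i)"
proof -
  obtain h :: "nat \<Rightarrow> ereal" where h: "range h \<subseteq> f ` A" "(SUP i\<in>A. f i) = (SUP n. h n)"
    using SUP_countable_SUP[OF assms, of f] by blast
  then have "\<forall>n. \<exists>a\<in>A. h n = f a" by blast
  then obtain a where a: "\<And>n. a n \<in> A" "\<And>n. h n = f (a n)" by metis
  show ?thesis
    by (rule that[of "range a"]) (use a h in \<open>auto simp: image_image\<close>)
qed

lemma alpha_min0_empty: "acceptance_set P \<psi> = {} \<Longrightarrow> alpha_min0 P \<psi> u = -\<infinity>"
  by (simp add: alpha_min0_def bot_ereal_def)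

section \<open>Maxitivity and the quantile representation, in both directions\<close>

context prob_space
begin

text \<open>Interchanging the suprema over \<open>Y\<close> and \<open>u\<close> leaves the
  pointwise supremum of quantiles, which is either the quantile function of
  \<open>st_Sup M Y\<close> or infinite at some level.\<close>

lemma bounded_countably_maxitive_if_SUP_quantile:
  assumes atomless: "atomless_prob_space M"
    and \<alpha>: "\<And>u. u \<in> {0<..<1} \<Longrightarrow> \<alpha> u \<noteq> \<infinity>"
    and \<psi>: "\<And>X. X \<in> RV M \<Longrightarrow> \<psi> X = (SUP u\<in>{0<..<1}. ereal (quantile M X u) - \<alpha> u)"
  shows "bounded_countably_maxitive M \<psi>"
  unfolding bounded_countably_maxitive_def
proof (intro allI impI)
  fix Y assume Y: "Y \<subseteq> RV M" "Y \<noteq> {}"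
  let ?s = "\<lambda>u. SUP X\<in>Y. ereal (quantile M X u)"
  have "(SUP X\<in>Y. \<psi> X) = (SUP X\<in>Y. SUP u\<in>{0<..<1}. ereal (quantile M X u) - \<alpha> u)"
    using Y \<psi> by (intro SUP_cong) auto
  also have "\<dots> = (SUP u\<in>{0<..<1}. SUP X\<in>Y. ereal (quantile M X u) - \<alpha> u)"
    by (rule SUP_commute)
  \<comment> \<open>Subtracting \<open>\<alpha> u\<close> commutes with the supremum because
    \<open>Y\<close> is nonempty and \<open>\<alpha> u\<close> is not
    \<open>\<infinity>\<close>.\<close>
  also have "\<dots> = (SUP u\<in>{0<..<1}. ?s u - \<alpha> u)"
    using Y \<alpha> by (intro SUP_cong SUP_ereal_minus_left) auto
  finally have SUP_eq: "(SUP X\<in>Y. \<psi> X) = (SUP u\<in>{0<..<1}. ?s u - \<alpha> u)" .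
  show "(SUP X\<in>Y. \<psi> X) = (if st_bdd_above M Y then \<psi> (st_Sup M Y) else \<infinity>)"
  proof (cases "st_bdd_above M Y")
    case True
    then have "?s u = ereal (quantile M (st_Sup M Y) u)" if "u \<in> {0<..<1}" for u
      using that Y st_bdd_above_iff[OF atomless Y] quantile_st_Sup[OF atomless Y]
      by (simp add: SUP_ereal_eq_if_bdd_above)
    then have "(SUP X\<in>Y. \<psi> X) = (SUP u\<in>{0<..<1}. ereal (quantile M (st_Sup M Y) u) - \<alpha> u)"
      unfolding SUP_eq by (intro SUP_cong) auto
    with True show ?thesis
      using \<psi>[OF st_Sup_in_RV[OF atomless Y]] by simp
  next
    case False
    then have "\<exists>u\<in>{0<..<1}. \<not> bdd_above ((\<lambda>X. quantile M X u) ` Y)"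
      using st_bdd_above_iff[OF atomless Y] by simp
    then obtain u where u: "u \<in> {0<..<1}" "\<not> bdd_above ((\<lambda>X. quantile M X u) ` Y)"
      by auto
    then have "?s u - \<alpha> u = \<infinity>"
      using Y \<alpha>[OF u(1)] by (simp add: SUP_ereal_eq_if_bdd_above)
    then have "\<infinity> \<le> (SUP X\<in>Y. \<psi> X)"
      unfolding SUP_eq using u(1) by (intro SUP_upper2[of u]) auto
    with False show ?thesis by simp
  qed
qed

text \<open>The supremum of the pair \<open>{X, Y}\<close> is \<open>Y\<close>, so maxitivity on
  this pair gives the inequality.\<close>

lemma bounded_countably_maxitive_mono:
  assumes atomless: "atomless_prob_space M" and \<psi>: "bounded_countably_maxitive M \<psi>"
    and XY: "X \<in> RV M" "Y \<in> RV M" "st_le M X Y"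
  shows "\<psi> X \<le> \<psi> Y"
proof -
  have sub: "{X, Y} \<subseteq> RV M" "{X, Y} \<noteq> {}"
    using XY by auto
  have bdd: "st_bdd_above M {X, Y}"
    unfolding st_bdd_above_def st_upper_bound_def using XY by (auto simp: st_le_def)
  have "st_Sup M {X, Y} = Y"
  proof (rule RV_eqI)
    fix u :: real assume u: "u \<in> {0<..<1}"
    then have "quantile M (st_Sup M {X, Y}) u = max (quantile M X u) (quantile M Y u)"
      using quantile_st_Sup[OF atomless sub bdd u] by (simp add: cSup_eq_Max)
    with u XY(3) show "quantile M (st_Sup M {X, Y}) u = quantile M Y u"
      by (simp add: st_le_def)
  qed (use st_Sup_in_RV[OF atomless sub bdd] XY in auto)
  moreover have "(SUP X\<in>{X, Y}. \<psi> X) = (if st_bdd_above M {X, Y} then \<psi> (st_Sup M {X, Y}) else \<infinity>)"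
    using \<psi>[unfolded bounded_countably_maxitive_def, rule_format, OF sub(1) _ sub(2)] by simp
  moreover have "\<psi> X \<le> (SUP X\<in>{X, Y}. \<psi> X)"
    by (intro SUP_upper) simp
  ultimately show ?thesis using bdd by simp
qed

lemma acceptance_set_greatest:
  assumes atomless: "atomless_prob_space M" and \<psi>: "bounded_countably_maxitive M \<psi>"
    and ne: "acceptance_set M \<psi> \<noteq> {}"
  obtains Z where "Z \<in> acceptance_set M \<psi>" "\<And>X. X \<in> acceptance_set M \<psi> \<Longrightarrow> st_le M X Z"
proof -
  let ?A = "acceptance_set M \<psi>"
  have "\<exists>C. C \<subseteq> ?A \<and> C \<noteq> {} \<and> countable C \<and>
      (SUP X\<in>C. ereal (quantile M X r)) = (SUP X\<in>?A. ereal (quantile M X r))" for r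
    using countable_subset_SUP_eq[OF ne, of "\<lambda>X. ereal (quantile M X r)"] by metis
  then obtain C where C: "\<And>r. C r \<subseteq> ?A" "\<And>r. C r \<noteq> {}" "\<And>r. countable (C r)"
      "\<And>r. (SUP X\<in>C r. ereal (quantile M X r)) = (SUP X\<in>?A. ereal (quantile M X r))"
    by metis
  \<comment> \<open>By left continuity the rational levels determine a quantile function, so countably many accepted
    elements already realize the supremum of all of them.\<close>
  define D where "D = (\<Union>r\<in>\<rat>. C r)"
  \<comment> \<open>Level 0 lies outside the open unit interval; being rational, it serves to show
    that \<open>D\<close> is nonempty.\<close>
  have "C 0 \<subseteq> D" by (auto simp: D_def)
  then have D: "D \<subseteq> RV M" "D \<noteq> {}" "D \<subseteq> ?A"
    using C(1) C(2)[of 0] by (auto simp: D_def acceptance_set_def)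
  have countable: "countable D"
    unfolding D_def using C(3) by (intro countable_UN countable_rat)
  have SUP_D: "(SUP X\<in>D. \<psi> X) = (if st_bdd_above M D then \<psi> (st_Sup M D) else \<infinity>)"
    using \<psi> D countable by (simp add: bounded_countably_maxitive_def)
  \<comment> \<open>This excludes the value \<open>\<infinity>\<close> assigned to unbounded sets,
    so \<open>D\<close> is bounded and its supremum is itself accepted.\<close>
  have "(SUP X\<in>D. \<psi> X) \<le> 0"
    using D by (intro SUP_least) (auto simp: acceptance_set_def)
  with SUP_D have bdd: "st_bdd_above M D" and le: "\<psi> (st_Sup M D) \<le> 0"
    by (auto split: if_splits)
  have Z: "st_Sup M D \<in> RV M"
    using atomless D(1,2) bdd by (rule st_Sup_in_RV)
  have "st_le M X (st_Sup M D)" if X: "X \<in> ?A" for X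
    unfolding st_le_def
  proof
    fix u :: real assume u: "u \<in> {0<..<1}"
    show "quantile M X u \<le> quantile M (st_Sup M D) u"
    proof (rule left_continuous_mono_le_rat[of "quantile M X" "quantile M (st_Sup M D)"])
      fix r :: real assume r: "r \<in> \<rat>" "r \<in> {0<..<1}"
      have "ereal (quantile M X r) \<le> (SUP X\<in>C r. ereal (quantile M X r))"
        unfolding C(4) using X by (rule SUP_upper)
      also have "\<dots> \<le> (SUP X\<in>D. ereal (quantile M X r))"
        using r by (intro SUP_subset_mono) (auto simp: D_def)
      also have "\<dots> = ereal (quantile M (st_Sup M D) r)"
        using r bdd D st_bdd_above_iff[OF atomless D(1,2)] quantile_st_Sup[OF atomless D(1,2) bdd r(2)]
        by (simp add: SUP_ereal_eq_if_bdd_above)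
      finally show "quantile M X r \<le> quantile M (st_Sup M D) r" by simp
    qed (use X Z u in \<open>auto intro: left_continuous_mono_quantile simp: acceptance_set_def\<close>)
  qed
  with that[of "st_Sup M D"] Z le show ?thesis
    by (simp add: acceptance_set_def)
qed

lemma bounded_countably_maxitive_alpha_min0:
  assumes atomless: "atomless_prob_space M" and \<psi>: "bounded_countably_maxitive M \<psi>"
    and not_minf: "\<forall>X\<in>RV M. \<psi> X \<noteq> -\<infinity>" and translation: "translation_property M \<psi>"
  shows "acceptance_set M \<psi> \<noteq> {} \<Longrightarrow> u \<in> {0<..<1} \<Longrightarrow> \<bar>alpha_min0 M \<psi> u\<bar> \<noteq> \<infinity>"
    and "X \<in> RV M \<Longrightarrow> \<psi> X = (SUP u\<in>{0<..<1}. ereal (quantile M X u) - alpha_min0 M \<psi> u)"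
proof -
  let ?A = "acceptance_set M \<psi>"
  \<comment> \<open>By translation, membership in the acceptance set decides every real sublevel set
    of \<psi>.\<close>
  have shift_accepted: "shift (- c) X \<in> ?A \<longleftrightarrow> \<psi> X \<le> ereal c" if "X \<in> RV M" for X c
    using that translation shift_in_RV[OF that]
    by (cases "\<psi> X") (auto simp: acceptance_set_def translation_property_def)
  have alpha_eq: "\<exists>Z\<in>?A. (\<forall>X\<in>?A. st_le M X Z) \<and>
      (\<forall>u\<in>{0<..<1}. alpha_min0 M \<psi> u = ereal (quantile M Z u))" if ne: "?A \<noteq> {}"
  proof -
    obtain Z where Z: "Z \<in> ?A" "\<And>X. X \<in> ?A \<Longrightarrow> st_le M X Z"
      using acceptance_set_greatest[OF atomless \<psi> ne] by blast
    have "alpha_min0 M \<psi> u = ereal (quantile M Z u)" if "u \<in> {0<..<1}" for u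
      unfolding alpha_min0_def using Z that
      by (intro antisym SUP_least SUP_upper) (auto simp: st_le_def)
    with Z show ?thesis by blast
  qed
  show "\<bar>alpha_min0 M \<psi> u\<bar> \<noteq> \<infinity>" if "?A \<noteq> {}" "u \<in> {0<..<1}"
    using alpha_eq[OF that(1)] that(2) by auto
  show "\<psi> X = (SUP u\<in>{0<..<1}. ereal (quantile M X u) - alpha_min0 M \<psi> u)" if X: "X \<in> RV M"
  proof (cases "?A = {}")
    case True
    \<comment> \<open>A real value of \<open>\<psi> X\<close> would make a shift of \<open>X\<close>
      accepted. The right-hand side is infinite as well, since \<open>alpha_min0\<close> is then
      \<open>-\<infinity>\<close>.\<close>
    then have "\<psi> X = \<infinity>"
      using shift_accepted[OF X] not_minf X by (cases "\<psi> X") auto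
    with True show ?thesis by (simp add: alpha_min0_empty)
  next
    case False
    then obtain Z where Z: "Z \<in> ?A" "\<And>X. X \<in> ?A \<Longrightarrow> st_le M X Z"
      and alpha: "\<And>u. u \<in> {0<..<1} \<Longrightarrow> alpha_min0 M \<psi> u = ereal (quantile M Z u)"
      using alpha_eq by blast
    have "W \<in> ?A \<longleftrightarrow> st_le M W Z" if "W \<in> RV M" for W
      using Z that bounded_countably_maxitive_mono[OF atomless \<psi> that, of Z]
      by (auto simp: acceptance_set_def)
    then have "\<psi> X \<le> ereal c \<longleftrightarrow> st_le M (shift (- c) X) Z" for c
      using shift_accepted[OF X] shift_in_RV[OF X] by blast
    moreover have "st_le M (shift (- c) X) Z \<longleftrightarrow>
        (SUP u\<in>{0<..<1}. ereal (quantile M X u) - alpha_min0 M \<psi> u) \<le> ereal c" for c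
      by (auto simp: st_le_def SUP_le_iff alpha quantile_shift[OF X] algebra_simps)
    ultimately have le_iff: "\<psi> X \<le> ereal c \<longleftrightarrow>
        (SUP u\<in>{0<..<1}. ereal (quantile M X u) - alpha_min0 M \<psi> u) \<le> ereal c" for c
      by (rule trans)
    \<comment> \<open>Extended reals with the same real upper bounds coincide.\<close>
    show ?thesis
      by (rule antisym; rule ereal_le_real; simp add: le_iff)
  qed
qed

end

theorem corollary5p3:
  fixes P :: "'a measure" and \<psi> :: "('a \<Rightarrow> real) set \<Rightarrow> ereal"
  assumes "atomless_prob_space P"
    and "\<forall>X\<in>RV P. \<psi> X \<noteq> -\<infinity>"
    and "translation_property P \<psi>"
  shows "(bounded_countably_maxitive P \<psi> \<longleftrightarrow>
            (\<exists>\<alpha> :: real \<Rightarrow> ereal. (\<forall>u\<in>{0<..<1}. \<alpha> u \<noteq> \<infinity>) \<and>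
               (\<forall>X\<in>RV P. \<psi> X = (SUP u\<in>{0<..<1}. ereal (quantile P X u) - \<alpha> u)))) \<and>
         (bounded_countably_maxitive P \<psi> \<longleftrightarrow>
            (acceptance_set P \<psi> \<noteq> {} \<longrightarrow> (\<forall>u\<in>{0<..<1}. \<bar>alpha_min0 P \<psi> u\<bar> \<noteq> \<infinity>)) \<and>
            (\<forall>X\<in>RV P. \<psi> X = (SUP u\<in>{0<..<1}. ereal (quantile P X u) - alpha_min0 P \<psi> u)))"
    (is "(?i \<longleftrightarrow> ?ii) \<and> (?i \<longleftrightarrow> ?iii)")
proof -
  interpret prob_space P
    using assms(1) by (simp add: atomless_prob_space_def)
  \<comment> \<open>The implications form a cycle: (i) to (iii), (iii) to (ii), (ii) to (i).\<close>
  have "?iii" if ?i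
    using bounded_countably_maxitive_alpha_min0[OF assms(1) that assms(2,3)]
    by (intro conjI impI ballI)
  moreover have "?ii" if ?iii
  \<comment> \<open>\<open>alpha_min0\<close> itself witnesses (ii): on the open unit interval it is
    real if something is accepted, and \<open>-\<infinity>\<close> otherwise.\<close>
  proof (rule exI[of _ "alpha_min0 P \<psi>"], intro conjI ballI)
    fix u :: real assume u: "u \<in> {0<..<1}"
    show "alpha_min0 P \<psi> u \<noteq> \<infinity>"
    proof (cases "acceptance_set P \<psi> = {}")
      case False
      then have "\<bar>alpha_min0 P \<psi> u\<bar> \<noteq> \<infinity>"
        using conjunct1[OF that] u by simp
      then show ?thesis by auto
    qed (simp add: alpha_min0_empty)
  next
    fix X assume "X \<in> RV P"
    with conjunct2[OF that] show "\<psi> X = (SUP u\<in>{0<..<1}. ereal (quantile P X u) - alpha_min0 P \<psi> u)"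
      by (rule bspec)
  qed
  moreover have "?i" if ?ii
  proof -
    from that obtain \<alpha> where "\<forall>u\<in>{0<..<1}. \<alpha> u \<noteq> \<infinity>"
      "\<forall>X\<in>RV P. \<psi> X = (SUP u\<in>{0<..<1}. ereal (quantile P X u) - \<alpha> u)"
      by (elim exE conjE)
    then show ?thesis
      by (intro bounded_countably_maxitive_if_SUP_quantile[OF assms(1), of \<alpha>]) (erule bspec, assumption)+
  qed
  ultimately show ?thesis by argo
qed

end
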